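(* Let $\vec{A}\subseteq\mathbb{Z}^d$ be a VAS, let $G=(\vec{Q},T)$ be a witness graph with set of states $\vec{Q}\subseteq\mathbb{N}_I^d$, let $s\geq1$ be an integer, and let $x=(1+\|\vec{A}\|_\infty)s$. Then there exists a set of indexes $J\subseteq\{1,\ldots,d\}$ such that the number of states of $\pi_J(G)$ is at most $x^{d^d}$, and every state $\vec{q}\in\vec{Q}$ with $\|\vec{q}\|_\infty<s$ is forward pumpable by a cycle of $\pi_J(G)$ and backward pumpable by a cycle of $\pi_J(G)$, each of length at most $d\,x^{d^d}$.
   Context: Let $\star$ be a new symbol, $\mathbb{N}_\star=\mathbb{N}\cup\{\star\}$, ordered by the usual order with $z\leq\star$ for all $z$, extended componentwise to vectors. For $I\subseteq\{1,\ldots,d\}$, $\mathbb{N}_I^d$ is the set of $\vec{c}\in\mathbb{N}_\star^d$ with $\{i\mid\vec{c}(i)=\star\}=I$; for such $\vec{c}$, $\|\vec{c}\|_\infty=\max_{i\notin I}\vec{c}(i)$ ($0$ if $I=\{1,\ldots,d\}$). For $L\subseteq\{1,\ldots,d\}$, $\pi_L(\vec{c})\in\mathbb{N}_{I\cup L}^d$ agrees with $\vec{c}$ outside $L$ and is $\star$ on $L$. A VAS is a finite $\vec{A}\subseteq\mathbb{Z}^d$, $\|\vec{A}\|_\infty=\max_{\vec{a}\in\vec{A}}\max_i|\vec{a}(i)|$ ($0$ if empty). A configuration is an element of some $\mathbb{N}_I^d$. For $\sigma=\vec{a}_1\cdots\vec{a}_k\in\vec{A}^*$, a run $\vec{x}\xrightarrow{\sigma}\vec{y}$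 with $\vec{x},\vec{y}\in\mathbb{N}_I^d$ is a sequence $\vec{c}_0,\ldots,\vec{c}_k\in\mathbb{N}_I^d$ with $\vec{c}_0=\vec{x}$, $\vec{c}_k=\vec{y}$, $\vec{c}_j=\vec{c}_{j-1}+\pi_I(\vec{a}_j)$ (addition componentwise outside $I$). A subreachability graph is $G=(\vec{Q},T)$ with $\vec{Q}\subseteq\mathbb{N}_I^d$ a nonempty finite set of states and $T\subseteq\vec{Q}\times\vec{A}\times\vec{Q}$ a finite set of transitions $(\vec{x},\vec{a},\vec{y})$ with $\vec{x}\xrightarrow{\vec{a}}\vec{y}$; a witness graph is a strongly connected one. $\pi_J(G)=(\{\pi_J(\vec{q})\mid\vec{q}\in\vec{Q}\},\{(\pi_J(\vec{x}),\vec{a},\pi_J(\vec{y}))\mid(\vec{x},\vec{a},\vec{y})\in T\})$. A cycle $\vec{q}\xrightarrow{\sigma}_H\vec{q}$ in a subreachability graph $H$ labelled by $\sigma=\vec{a}_1\cdots\vec{a}_k$ is a sequence of transitions $(\vec{c}_{j-1},\vec{a}_j,\vec{c}_j)$ of $H$ with $\vec{c}_0=\vec{c}_k=\vec{q}$; its length is $k$. A word $\sigma$ is forward iterable from a configuration $\vec{c}$ if there is a run $\vec{c}\xrightarrow{\sigma}\vec{y}$ with $\vec{c}\leq\vec{y}$; its forward limit is then $\pi_L(\vec{c})$ with $L=\{i\mid\vec{c}(i)\neq\vec{y}(i)\}$. Symmetrically $\sigma$ is backward iterable from $\vec{c}$ if there is a run $\vec{x}\xrightarrow{\sigma}\vec{c}$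 with $\vec{c}\leq\vec{x}$, with backward limit $\pi_L(\vec{c})$, $L=\{i\mid\vec{c}(i)\neq\vec{x}(i)\}$. A configuration $\vec{c}$ is forward (resp. backward) pumpable by a cycle $\vec{q}\xrightarrow{\sigma}_H\vec{q}$ if $\sigma$ is forward (resp. backward) iterable from $\vec{c}$ with forward (resp. backward) limit equal to $\vec{q}$. *)

theory Defs
  imports "HOL-Library.Extended_Nat" "HOL-Library.Cardinality"
begin

text \<open>
  The index set \<open>{1, ..., d}\<close> is the universe of a finite type \<open>'d\<close>, so that \<open>d = CARD('d)\<close>.
  The set of naturals extended by a star is \<^typ>\<open>enat\<close>: the star is \<open>\<infinity>\<close>, and the
  order on \<^typ>\<open>enat\<close> (lifted pointwise to functions) is the one required.
  The set \<open>stars c\<close> is the unique \<open>I\<close> with \<open>c \<in> configs I\<close>.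
\<close>

type_synonym 'd config = "'d \<Rightarrow> enat"
type_synonym 'd action = "'d \<Rightarrow> int"

definition stars :: "'d config \<Rightarrow> 'd set" where
  "stars c = {i. c i = \<infinity>}"

definition configs :: "'d set \<Rightarrow> 'd config set" where
  "configs I = {c. stars c = I}"

text \<open>In both norms the inserted \<open>0\<close> only matters when there is nothing to maximise over.\<close>

definition config_norm :: "'d::finite config \<Rightarrow> nat" where
  "config_norm c = Max (insert 0 ((\<lambda>i. the_enat (c i)) ` (- stars c)))"

definition vas_norm :: "'d::finite action set \<Rightarrow> nat" where
  "vas_norm A = Max (insert 0 {nat \<bar>a i\<bar> | a i. a \<in> A})"

definition proj :: "'d set \<Rightarrow> 'd config \<Rightarrow> 'd config" where
  "proj L c = (\<lambda>i. if i \<in> L then \<infinity> else c i)"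

text \<open>
  One step \<open>y = x + \<pi>\<^sub>I(a)\<close> between configurations with the same set \<open>I\<close> of starred
  components; the equation in \<^typ>\<open>int\<close> forces the sum to be nonnegative outside \<open>I\<close>.
\<close>

definition step :: "'d config \<Rightarrow> 'd action \<Rightarrow> 'd config \<Rightarrow> bool" where
  "step x a y \<longleftrightarrow> stars x = stars y \<and>
     (\<forall>i. i \<notin> stars x \<longrightarrow> int (the_enat (y i)) = int (the_enat (x i)) + a i)"

text \<open>Only the values of \<open>c\<close> at \<open>0, ..., length \<sigma>\<close> matter in the next definition.\<close>

definition labelled_path ::
    "('s \<Rightarrow> 'l \<Rightarrow> 's \<Rightarrow> bool) \<Rightarrow> 's \<Rightarrow> 'l list \<Rightarrow> 's \<Rightarrow> bool" where
  "labelled_path R x \<sigma> y \<longleftrightarrow>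
     (\<exists>c :: nat \<Rightarrow> 's. c 0 = x \<and> c (length \<sigma>) = y \<and>
        (\<forall>j < length \<sigma>. R (c j) (\<sigma> ! j) (c (Suc j))))"

definition run :: "'d config \<Rightarrow> 'd action list \<Rightarrow> 'd config \<Rightarrow> bool" where
  "run = labelled_path step"

record 'd vas_graph =
  states :: "'d config set"
  transitions :: "('d config \<times> 'd action \<times> 'd config) set"

definition subreachability_graph ::
    "'d action set \<Rightarrow> 'd set \<Rightarrow> 'd vas_graph \<Rightarrow> bool" where
  "subreachability_graph A I G \<longleftrightarrow>
     states G \<subseteq> configs I \<and> states G \<noteq> {} \<and> finite (states G) \<and>
     transitions G \<subseteq> states G \<times> A \<times> states G \<and> finite (transitions G) \<and>
     (\<forall>(x, a, y) \<in> transitions G. run x [a] y)"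

definition graph_path ::
    "'d vas_graph \<Rightarrow> 'd config \<Rightarrow> 'd action list \<Rightarrow> 'd config \<Rightarrow> bool" where
  "graph_path G p \<sigma> q \<longleftrightarrow> p \<in> states G \<and> q \<in> states G \<and>
     labelled_path (\<lambda>x a y. (x, a, y) \<in> transitions G) p \<sigma> q"

definition witness_graph ::
    "'d action set \<Rightarrow> 'd set \<Rightarrow> 'd vas_graph \<Rightarrow> bool" where
  "witness_graph A I G \<longleftrightarrow> subreachability_graph A I G \<and>
     (\<forall>p \<in> states G. \<forall>q \<in> states G. \<exists>\<sigma>. graph_path G p \<sigma> q)"

definition proj_graph :: "'d set \<Rightarrow> 'd vas_graph \<Rightarrow> 'd vas_graph" where
  "proj_graph J G =
     \<lparr> states = proj J ` states G,
       transitions = (\<lambda>(x, a, y). (proj J x, a, proj J y)) ` transitions G \<rparr>"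

definition cycle_at :: "'d vas_graph \<Rightarrow> 'd config \<Rightarrow> 'd action list \<Rightarrow> bool" where
  "cycle_at H q \<sigma> \<longleftrightarrow> graph_path H q \<sigma> q"

text \<open>
  \<open>forward_limit \<sigma> c l\<close> says that \<open>\<sigma>\<close> is forward iterable from \<open>c\<close> and that its forward limit
  is \<open>l\<close>; the limit is unique because a word and a source determine the target of a run.
  Dually, a word and a target determine the source.
\<close>

definition forward_limit :: "'d action list \<Rightarrow> 'd config \<Rightarrow> 'd config \<Rightarrow> bool" where
  "forward_limit \<sigma> c l \<longleftrightarrow>
     (\<exists>y. run c \<sigma> y \<and> c \<le> y \<and> l = proj {i. c i \<noteq> y i} c)"

definition backward_limit :: "'d action list \<Rightarrow> 'd config \<Rightarrow> 'd config \<Rightarrow> bool" where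
  "backward_limit \<sigma> c l \<longleftrightarrow>
     (\<exists>x. run x \<sigma> c \<and> c \<le> x \<and> l = proj {i. c i \<noteq> x i} c)"

definition forward_pumpable ::
    "'d vas_graph \<Rightarrow> 'd config \<Rightarrow> 'd config \<Rightarrow> 'd action list \<Rightarrow> bool" where
  "forward_pumpable H c q \<sigma> \<longleftrightarrow> cycle_at H q \<sigma> \<and> forward_limit \<sigma> c q"

definition backward_pumpable ::
    "'d vas_graph \<Rightarrow> 'd config \<Rightarrow> 'd config \<Rightarrow> 'd action list \<Rightarrow> bool" where
  "backward_pumpable H c q \<sigma> \<longleftrightarrow> cycle_at H q \<sigma> \<and> backward_limit \<sigma> c q"

end

theory Submission
  imports Defs "HOL-Library.FuncSet"
begin

text \<open>
  Write \<open>\<mu>\<^sub>n = x ^ n\<^bsup>n-1\<^esup>\<close>, and let \<open>J\<close> be a smallest set of indexes such that, with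
  \<open>n = d - |J|\<close>, every state is below \<open>\<mu>\<^sub>n\<close> on the \<open>n\<close> components outside \<open>J\<close>; then \<open>\<pi>\<^sub>J(G)\<close> has
  at most \<open>\<mu>\<^sub>n\<^sup>n\<close> states. The rest is an argument in the style of Rackoff. For \<open>I \<subseteq> K \<subset> J\<close>, minimality
  of \<open>J\<close> provides a state with a component in \<open>J - K\<close> of size at least \<open>\<mu>\<^sub>k\<close>, where
  \<open>k = d - |K|\<close>, and a shortest path of \<open>\<pi>\<^sub>K(G)\<close> to such a state has length at most
  \<open>\<mu>\<^sub>k\<^sup>k\<close>. Concatenating such paths yields a run from \<open>q\<close> making all components in \<open>J\<close> large, since
  \<open>\<mu>\<^sub>k\<close> is large enough to absorb the losses on the paths that follow. A simple path of \<open>\<pi>\<^sub>J(G)\<close>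
  leads back to \<open>\<pi>\<^sub>J(q)\<close>. As \<open>J\<close> depends only on the states, reversing all transitions gives the
  backward case with the same \<open>J\<close>.
\<close>

section \<open>Labelled paths\<close>

lemma labelled_path_Nil [simp]: "labelled_path R x [] y \<longleftrightarrow> x = y"
  by (auto simp: labelled_path_def)

lemma labelled_path_Cons:
  "labelled_path R x (a # \<sigma>) y \<longleftrightarrow> (\<exists>z. R x a z \<and> labelled_path R z \<sigma> y)"
proof
  assume "labelled_path R x (a # \<sigma>) y"
  then obtain c where c: "c 0 = x" "c (Suc (length \<sigma>)) = y"
    "\<forall>j < Suc (length \<sigma>). R (c j) ((a # \<sigma>) ! j) (c (Suc j))"
    by (auto simp: labelled_path_def)
  have "R x a (c 1)" using c by fastforce
  moreover have "labelled_path R (c 1) \<sigma> y"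
    unfolding labelled_path_def
    using c by (intro exI[of _ "\<lambda>j. c (Suc j)"]) fastforce
  ultimately show "\<exists>z. R x a z \<and> labelled_path R z \<sigma> y" by blast
next
  assume "\<exists>z. R x a z \<and> labelled_path R z \<sigma> y"
  then obtain z c where "R x a z" and c: "c 0 = z" "c (length \<sigma>) = y"
    "\<forall>j < length \<sigma>. R (c j) (\<sigma> ! j) (c (Suc j))"
    by (auto simp: labelled_path_def)
  then show "labelled_path R x (a # \<sigma>) y"
    unfolding labelled_path_def
    by (intro exI[of _ "\<lambda>j. case j of 0 \<Rightarrow> x | Suc k \<Rightarrow> c k"])
      (auto simp: nth_Cons split: nat.split)
qed

lemma labelled_path_append:
  "labelled_path R x (\<sigma> @ \<tau>) y \<longleftrightarrow> (\<exists>z. labelled_path R x \<sigma> z \<and> labelled_path R z \<tau> y)"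
  by (induction \<sigma> arbitrary: x) (auto simp: labelled_path_Cons)

lemma labelled_path_map:
  assumes "labelled_path R x \<sigma> y" and "\<And>u a v. R u a v \<Longrightarrow> S (f u) a (f v)"
  shows "labelled_path S (f x) \<sigma> (f y)"
  using assms(1) by (induction \<sigma> arbitrary: x) (auto simp: labelled_path_Cons dest: assms(2))

lemma labelled_path_rev:
  assumes "labelled_path R x \<sigma> y" and "\<And>u a v. R u a v \<Longrightarrow> S v (g a) u"
  shows "labelled_path S y (rev (map g \<sigma>)) x"
  using assms(1)
  by (induction \<sigma> arbitrary: x)
    (auto simp: labelled_path_Cons labelled_path_append dest: assms(2))

text \<open>Take a path that is shortest among all paths from \<open>x\<close> to any point
  satisfying \<open>P\<close>. No earlier point satisfies \<open>P\<close>, and none repeats, since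
  a loop could be cut out. Counting only points that fail \<open>P\<close> matters later, when those
  satisfying \<open>P\<close> may be arbitrarily many.\<close>

lemma labelled_path_short:
  assumes path: "labelled_path R x \<sigma> y" and "P y"
    and fin: "finite S" and S: "\<And>u a v. R u a v \<Longrightarrow> u \<in> S"
  obtains \<tau> z where "labelled_path R x \<tau> z" "P z" "length \<tau> \<le> card {u \<in> S. \<not> P u}"
proof -
  define reach where "reach \<tau> \<longleftrightarrow> (\<exists>z. labelled_path R x \<tau> z \<and> P z)" for \<tau>
  have "reach \<sigma>" using assms by (auto simp: reach_def)
  then obtain \<tau> where "reach \<tau>" and least: "\<And>\<rho>. reach \<rho> \<Longrightarrow> length \<tau> \<le> length \<rho>"
    using ex_has_least_nat[of reach \<sigma> length] by blast
  then obtain c where c: "c 0 = x" "P (c (length \<tau>))"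
    "\<And>j. j < length \<tau> \<Longrightarrow> R (c j) (\<tau> ! j) (c (Suc j))"
    by (auto simp: reach_def labelled_path_def)
  have upto: "labelled_path R x (take j \<tau>) (c j)" if "j \<le> length \<tau>" for j
    unfolding labelled_path_def using c that by (intro exI[of _ c]) auto
  have from_j: "labelled_path R (c j) (drop j \<tau>) (c (length \<tau>))" if "j \<le> length \<tau>" for j
    unfolding labelled_path_def using c that by (intro exI[of _ "\<lambda>k. c (j + k)"]) auto
  have "\<not> P (c j)" if "j < length \<tau>" for j
    using least[of "take j \<tau>"] upto[of j] that by (auto simp: reach_def)
  then have "c ` {..<length \<tau>} \<subseteq> {u \<in> S. \<not> P u}"
    using c(3) S by fastforce
  moreover have "inj_on c {..<length \<tau>}"
  proof (rule linorder_inj_onI)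
    fix i j assume ij: "i < j" "i \<in> {..<length \<tau>}" "j \<in> {..<length \<tau>}"
    show "c i \<noteq> c j"
    proof
      assume "c i = c j"
      then have "labelled_path R x (take i \<tau> @ drop j \<tau>) (c (length \<tau>))"
        using upto[of i] from_j[of j] ij by (auto simp: labelled_path_append)
      then have "reach (take i \<tau> @ drop j \<tau>)" using c(2) by (auto simp: reach_def)
      from least[OF this] ij show False by auto
    qed
  qed auto
  ultimately have "length \<tau> \<le> card {u \<in> S. \<not> P u}"
    using card_inj_on_le[of c "{..<length \<tau>}"] fin by auto
  then show ?thesis using that upto[of "length \<tau>"] c(2) by auto
qed

section \<open>Configurations, projections and norms\<close>

lemma proj_proj: "K \<subseteq> J \<Longrightarrow> proj J (proj K c) = proj J c"
  by (auto simp: proj_def fun_eq_iff)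

text \<open>As a union of finite ranges the set is visibly finite for finite \<open>A\<close> and
  unchanged when actions are negated.\<close>

lemma vas_norm_eq: "vas_norm A = Max (insert 0 (\<Union>a \<in> A. range (\<lambda>i. nat \<bar>a i\<bar>)))"
  unfolding vas_norm_def by (rule arg_cong[where f = "\<lambda>S. Max (insert 0 S)"]) auto

lemma vas_norm_uminus: "vas_norm (uminus ` A) = vas_norm A"
  by (simp add: vas_norm_eq)

lemma abs_le_vas_norm:
  fixes A :: "'d::finite action set"
  assumes "finite A" and "a \<in> A"
  shows "\<bar>a i\<bar> \<le> int (vas_norm A)"
proof -
  have "nat \<bar>a i\<bar> \<le> vas_norm A"
    unfolding vas_norm_eq using assms by (intro Max_ge) auto
  then show ?thesis by simp
qed

lemma le_config_norm:
  fixes c :: "'d::finite config"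
  assumes "c i \<noteq> \<infinity>"
  shows "c i \<le> enat (config_norm c)"
proof -
  have "the_enat (c i) \<le> config_norm c"
    unfolding config_norm_def using assms by (intro Max_ge) (auto simp: stars_def)
  then show ?thesis using assms by (cases "c i") auto
qed

definition bounded_configs :: "'d set \<Rightarrow> nat \<Rightarrow> 'd config set" where
  "bounded_configs K b = {c. (\<forall>i \<in> K. c i = \<infinity>) \<and> (\<forall>i \<in> - K. c i < enat b)}"

text \<open>A member is determined by its components outside \<open>K\<close>, each a natural below
  \<open>b\<close>; the strict bound already excludes \<infinity> there.\<close>

lemma bounded_configs:
  fixes K :: "'d::finite set"
  shows finite_bounded_configs: "finite (bounded_configs K b)"
    and card_bounded_configs: "card (bounded_configs K b) \<le> b ^ card (- K)"
proof -
  let ?F = "PiE (- K) (\<lambda>_. {..<b})"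
  let ?h = "\<lambda>f i. if i \<in> K then \<infinity> else enat (f i)"
  have fin: "finite ?F" by (intro finite_PiE) auto
  have sub: "bounded_configs K b \<subseteq> ?h ` ?F"
  proof
    fix c assume c: "c \<in> bounded_configs K b"
    have lt: "c i < enat b" if "i \<notin> K" for i
      using c that by (simp add: bounded_configs_def)
    have "c = ?h (\<lambda>i \<in> - K. the_enat (c i))"
    proof
      fix i
      show "c i = ?h (\<lambda>i \<in> - K. the_enat (c i)) i"
        using c lt[of i] by (cases "c i") (auto simp: bounded_configs_def)
    qed
    moreover have "(\<lambda>i \<in> - K. the_enat (c i)) \<in> ?F"
    proof (rule restrict_PiE_iff[THEN iffD2], rule ballI)
      fix i assume "i \<in> - K"
      then show "the_enat (c i) \<in> {..<b}"
        using lt[of i] by (cases "c i") auto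
    qed
    ultimately show "c \<in> ?h ` ?F" by blast
  qed
  show "finite (bounded_configs K b)"
    using sub fin finite_subset by blast
  have "card (bounded_configs K b) \<le> card (?h ` ?F)"
    using sub fin by (intro card_mono) auto
  also have "\<dots> \<le> card ?F" by (rule card_image_le[OF fin])
  also have "\<dots> = b ^ card (- K)" by (simp add: card_PiE)
  finally show "card (bounded_configs K b) \<le> b ^ card (- K)" .
qed

section \<open>Thresholds\<close>

text \<open>For \<open>n = 0\<close> truncated subtraction gives the exponent
  \<open>0 ^ 0 = 1\<close>, hence the value \<open>x\<close>, which agrees with
  monotonicity.\<close>

definition threshold :: "nat \<Rightarrow> nat \<Rightarrow> nat" where
  "threshold x n = x ^ (n ^ (n - 1))"

text \<open>Used with \<open>k = 1\<close> for the exponent of \<open>threshold\<close> and with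
  \<open>k = 0\<close> for that of its \<open>n\<close>-th power. The case \<open>m = 0\<close> is
  separate because \<open>0 ^ 0 = 1\<close>.\<close>

lemma power_self_mono:
  fixes m n :: nat
  assumes "m \<le> n"
  shows "m ^ (m - k) \<le> n ^ (n - k)"
proof (cases "m = 0")
  case True
  then show ?thesis by (cases "n = 0") auto
next
  case False
  have "m ^ (m - k) \<le> n ^ (m - k)" using assms by (rule power_mono) simp
  also have "\<dots> \<le> n ^ (n - k)" using assms False by (intro power_increasing) auto
  finally show ?thesis .
qed

lemma threshold_mono: "1 \<le> x \<Longrightarrow> m \<le> n \<Longrightarrow> threshold x m \<le> threshold x n"
  unfolding threshold_def by (intro power_increasing power_self_mono)

lemma threshold_power:
  assumes "0 < n"
  shows "threshold x n ^ n = x ^ (n ^ n)"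
proof -
  have "n ^ (n - 1) * n = n ^ n" using assms by (cases n) (simp_all add: mult.commute)
  then show ?thesis by (simp add: threshold_def flip: power_mult)
qed

lemma threshold_power_le:
  assumes "1 \<le> x" and "n \<le> d"
  shows "threshold x n ^ n \<le> x ^ (d ^ d)"
proof (cases "n = 0")
  case True
  then show ?thesis using assms by simp
next
  case False
  then show ?thesis
    using assms power_self_mono[of n d 0] by (simp add: threshold_power power_increasing)
qed

text \<open>
  With \<open>n\<close> components still to be raised, a component of this size survives the paths to come and
  ends up at \<open>s\<close> or above.
\<close>

definition reserve :: "nat \<Rightarrow> nat \<Rightarrow> nat \<Rightarrow> nat \<Rightarrow> nat" where
  "reserve a s x n = s + a * (\<Sum>j = 1..n. threshold x j ^ j)"

lemma reserve_Suc: "reserve a s x (Suc n) = reserve a s x n + a * threshold x (Suc n) ^ Suc n"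
  by (simp add: reserve_def algebra_simps)

text \<open>This inequality explains the exponent in \<open>threshold\<close>: the next summand of
  \<open>reserve\<close> is \<open>a * x ^ (m ^ m)\<close>, the factor \<open>1 + a\<close> is at
  most \<open>x\<close>, and \<open>m ^ m + 1\<close> is at most \<open>(m + 1) ^ m\<close>.\<close>

lemma reserve_le_threshold:
  assumes "1 \<le> s" and x: "x = (1 + a) * s"
  shows "reserve a s x n \<le> threshold x (Suc n)"
proof (induction n)
  case 0
  then show ?case by (simp add: reserve_def threshold_def x)
next
  case (Suc n)
  let ?m = "Suc n"
  have x1: "1 \<le> x" using assms by auto
  have xa: "1 + a \<le> x" using mult_le_mono2[OF \<open>1 \<le> s\<close>, of "1 + a"] x by simp
  have "?m ^ n \<le> ?m ^ ?m" by (intro power_increasing) auto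
  then have "threshold x ?m \<le> x ^ (?m ^ ?m)"
    unfolding threshold_def using x1 by (intro power_increasing) auto
  then have "reserve a s x ?m \<le> (1 + a) * x ^ (?m ^ ?m)"
    using Suc threshold_power[of ?m x] unfolding reserve_Suc by simp
  also have "\<dots> \<le> x * x ^ (?m ^ ?m)" using xa by (rule mult_le_mono1)
  also have "\<dots> = x ^ (?m ^ ?m + 1)" by simp
  also have "\<dots> \<le> x ^ (Suc ?m ^ ?m)"
  proof (rule power_increasing)
    have "?m ^ ?m < Suc ?m ^ ?m" by (rule power_strict_mono) auto
    then show "?m ^ ?m + 1 \<le> Suc ?m ^ ?m" by simp
  qed (rule x1)
  finally show ?case by (simp add: threshold_def)
qed

section \<open>Runs along paths of a projected graph\<close>

abbreviation edge :: "'d vas_graph \<Rightarrow> 'd config \<Rightarrow> 'd action \<Rightarrow> 'd config \<Rightarrow> bool" where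
  "edge G x a y \<equiv> (x, a, y) \<in> transitions G"

lemma edge_proj_graph:
  "edge (proj_graph K G) p a r \<longleftrightarrow> (\<exists>u v. edge G u a v \<and> p = proj K u \<and> r = proj K v)"
  by (force simp: proj_graph_def)

lemma edge_proj_graph_mono:
  assumes "K \<subseteq> J" and "edge (proj_graph K G) p a r"
  shows "edge (proj_graph J G) (proj J p) a (proj J r)"
  using assms(2) proj_proj[OF assms(1)] unfolding edge_proj_graph by metis

lemma states_proj_graph [simp]: "states (proj_graph K G) = proj K ` states G"
  by (simp add: proj_graph_def)

lemma witness_graphD:
  assumes "witness_graph A I G"
  shows "states G \<noteq> {}" and "finite (states G)"
    and "q \<in> states G \<Longrightarrow> stars q = I"
    and "edge G u a v \<Longrightarrow> u \<in> states G \<and> a \<in> A \<and> v \<in> states G \<and> step u a v"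
    and "p \<in> states G \<Longrightarrow> q \<in> states G \<Longrightarrow> \<exists>\<sigma>. labelled_path (edge G) p \<sigma> q"
proof -
  have S: "subreachability_graph A I G" using assms by (simp add: witness_graph_def)
  show "states G \<noteq> {}" "finite (states G)" using S by (simp_all add: subreachability_graph_def)
  show "stars q = I" if "q \<in> states G"
    using S that by (auto simp: subreachability_graph_def configs_def)
  show "u \<in> states G \<and> a \<in> A \<and> v \<in> states G \<and> step u a v" if "edge G u a v"
    using S that by (auto simp: subreachability_graph_def run_def labelled_path_Cons)
  show "\<exists>\<sigma>. labelled_path (edge G) p \<sigma> q" if "p \<in> states G" "q \<in> states G"
    using assms that by (simp add: witness_graph_def graph_path_def)
qed

text \<open>Outside \<open>K\<close> the step copies the one from \<open>u\<close>; on
  \<open>K\<close> a component loses at most \<open>N\<close>, so the margin keeps it at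
  \<open>r\<close> or above. Neither \<open>y\<close> nor \<open>z\<close> need be a state.\<close>

lemma step_lift:
  assumes step: "step u a v" and eq: "proj K u = proj K y" and IK: "stars u \<subseteq> K" "stars y \<subseteq> K"
    and a: "\<And>i. \<bar>a i\<bar> \<le> int N" and y: "\<And>i. i \<in> K \<Longrightarrow> enat (r + N) \<le> y i"
  obtains z where "step y a z" "proj K z = proj K v" "\<And>i. i \<in> K \<Longrightarrow> enat r \<le> z i"
proof -
  \<comment> \<open>The case \<infinity> is split off because \<open>the_enat\<close> carries no
    information there; \<open>nonneg\<close> below shows that \<open>nat\<close> truncates
    nothing.\<close>
  define z where
    "z i = (if y i = \<infinity> then \<infinity> else enat (nat (int (the_enat (y i)) + a i)))" for i
  have r: "int r \<le> int (the_enat (y i)) + a i" if "i \<in> K" "y i \<noteq> \<infinity>" for i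
    using y[OF that(1)] a[of i] that(2) by (cases "y i") auto
  have agree: "z i = v i" "0 \<le> int (the_enat (y i)) + a i" if "i \<notin> K" for i
  proof -
    have "y i = u i" using fun_cong[OF eq, of i] that by (simp add: proj_def)
    moreover have "i \<notin> stars u" using IK(1) that by blast
    moreover have "i \<notin> stars v" "int (the_enat (v i)) = int (the_enat (u i)) + a i"
      using step calculation(2) by (auto simp: step_def)
    ultimately show "z i = v i" "0 \<le> int (the_enat (y i)) + a i"
      by (auto simp: z_def stars_def)
  qed
  have nonneg: "0 \<le> int (the_enat (y i)) + a i" if "y i \<noteq> \<infinity>" for i
    using r[of i] agree(2)[of i] that by (cases "i \<in> K") auto
  show ?thesis
  proof (rule that)
    show "step y a z"
      using nonneg by (auto simp: step_def stars_def z_def)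
    show "proj K z = proj K v"
      using agree(1) by (auto simp: proj_def)
    show "enat r \<le> z i" if "i \<in> K" for i
      using r[OF that] by (auto simp: z_def)
  qed
qed

text \<open>Consecutive edges of the projected path may come from edges of \<open>G\<close> whose
  endpoints differ on \<open>K\<close>, so they need not chain in \<open>G\<close>. They still chain
  as steps if every letter is paid for on \<open>K\<close> by \<open>vas_norm A\<close>.\<close>

lemma run_lift:
  assumes W: "witness_graph A I G" and A: "finite A" and IK: "I \<subseteq> K"
    and path: "labelled_path (edge (proj_graph K G)) (proj K y) \<sigma> p" and "stars y = I"
    and "\<And>i. i \<in> K \<Longrightarrow> enat (r + vas_norm A * length \<sigma>) \<le> y i"
  shows "\<exists>z. run y \<sigma> z \<and> proj K z = p \<and> (\<forall>i \<in> K. enat r \<le> z i)"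
  using path \<open>stars y = I\<close> assms(6)
proof (induction \<sigma> arbitrary: y)
  case Nil
  then show ?case by (auto simp: run_def)
next
  case (Cons a \<sigma>)
  let ?r = "r + vas_norm A * length \<sigma>"
  obtain u v where uv: "edge G u a v" "proj K u = proj K y"
    and rest: "labelled_path (edge (proj_graph K G)) (proj K v) \<sigma> p"
    using Cons.prems(1) by (auto simp: labelled_path_Cons edge_proj_graph)
  have u: "step u a v" "stars u = I" and a: "a \<in> A"
    using witness_graphD(3,4)[OF W] uv(1) by blast+
  have "enat (?r + vas_norm A) \<le> y i" if "i \<in> K" for i
    using Cons.prems(3)[OF that] by (simp add: algebra_simps)
  then obtain y' where y': "step y a y'" "proj K y' = proj K v" "\<And>i. i \<in> K \<Longrightarrow> enat ?r \<le> y' i"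
    using step_lift[OF u(1) uv(2), of "vas_norm A" ?r] u(2) Cons.prems(2) IK
      abs_le_vas_norm[OF A a] by blast
  moreover have "stars y' = I" using y'(1) Cons.prems(2) by (simp add: step_def)
  ultimately show ?case
    using Cons.IH[of y'] rest by (auto simp: run_def labelled_path_Cons)
qed

lemma run_stars: "run x \<sigma> y \<Longrightarrow> stars y = stars x"
  unfolding run_def
  by (induction \<sigma> arbitrary: x) (auto simp: labelled_path_Cons step_def)

section \<open>Forward pumping\<close>

text \<open>The bound shrinks as \<open>J\<close> grows, so the property need not pass to larger
  sets. Being strict, it forces every starred component into \<open>J\<close>.\<close>

definition bounded_outside :: "nat \<Rightarrow> 'd config set \<Rightarrow> 'd::finite set \<Rightarrow> bool" where
  "bounded_outside x Q J \<longleftrightarrow> (\<forall>q \<in> Q. \<forall>i \<in> - J. q i < enat (threshold x (card (- J))))"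

text \<open>\<open>J\<close> is constrained only through \<open>x\<close> and
  \<open>states G\<close>, so a graph and its reversal can be instances with the same
  \<open>J\<close>.\<close>

locale pumping =
  fixes A :: "'d::finite action set" and I :: "'d set" and G :: "'d vas_graph"
    and s x :: nat and J :: "'d set"
  assumes finite_A: "finite A" and witness: "witness_graph A I G"
    and s: "1 \<le> s" and x: "x = (1 + vas_norm A) * s"
    and bounded: "bounded_outside x (states G) J"
    and minimal: "\<And>K. K \<subset> J \<Longrightarrow> \<not> bounded_outside x (states G) K"
begin

lemma x_ge_1: "1 \<le> x"
  using s x by simp

lemma I_subset_J: "I \<subseteq> J"
proof
  fix i assume "i \<in> I"
  obtain q where "q \<in> states G" using witness_graphD(1)[OF witness] by blast
  moreover have "q i = \<infinity>"
    using witness_graphD(3)[OF witness] calculation \<open>i \<in> I\<close> by (auto simp: stars_def)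
  ultimately show "i \<in> J" using bounded by (force simp: bounded_outside_def)
qed

lemma card_states_proj:
  "card (states (proj_graph J G)) \<le> threshold x (card (- J)) ^ card (- J)"
proof -
  have "states (proj_graph J G) \<subseteq> bounded_configs J (threshold x (card (- J)))"
    using bounded by (auto simp: bounded_configs_def bounded_outside_def proj_def)
  then show ?thesis
    using card_bounded_configs finite_bounded_configs card_mono order_trans by meson
qed

lemma proj_connected:
  assumes "p \<in> proj K ` states G" and "q \<in> proj K ` states G"
  shows "\<exists>\<sigma>. labelled_path (edge (proj_graph K G)) p \<sigma> q"
proof -
  obtain u v where uv: "u \<in> states G" "v \<in> states G" "p = proj K u" "q = proj K v"
    using assms by blast
  then obtain \<sigma> where "labelled_path (edge G) u \<sigma> v"
    using witness_graphD(5)[OF witness] by blast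
  then have "labelled_path (edge (proj_graph K G)) (proj K u) \<sigma> (proj K v)"
    by (rule labelled_path_map) (auto simp: edge_proj_graph)
  then show ?thesis using uv by blast
qed

lemma proj_path_states:
  assumes "labelled_path (edge (proj_graph K G)) p \<sigma> r" and "p \<in> proj K ` states G"
  shows "r \<in> proj K ` states G"
  using assms
  by (induction \<sigma> arbitrary: p)
    (auto simp: labelled_path_Cons edge_proj_graph dest!: witness_graphD(4)[OF witness])

lemma short_proj_path:
  assumes "p \<in> proj K ` states G" and "r \<in> proj K ` states G" and "P r"
  obtains \<sigma> t where "labelled_path (edge (proj_graph K G)) p \<sigma> t" "P t"
    "length \<sigma> \<le> card {u \<in> proj K ` states G. \<not> P u}"
proof -
  obtain \<sigma> where "labelled_path (edge (proj_graph K G)) p \<sigma> r"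
    using proj_connected assms(1,2) by blast
  then show ?thesis
    using assms(3)
  proof (rule labelled_path_short[where P = P])
    show "finite (proj K ` states G)" using witness_graphD(2)[OF witness] by simp
    show "u \<in> proj K ` states G" if "edge (proj_graph K G) u a v" for u a v
      using that witness_graphD(4)[OF witness] by (auto simp: edge_proj_graph)
  qed (rule that)
qed

text \<open>The invariant while \<open>K\<close> grows from \<open>I\<close> to \<open>J\<close>.
  Outside \<open>K\<close>, \<open>y\<close> agrees with a state, so the next path can start; the
  reserve pays for the remaining paths, the return included. The stage that leaves \<open>n\<close>
  unraised components has length at most \<open>threshold x n ^ n\<close>, and the sum collects the
  stages done.\<close>

definition raised :: "'d config \<Rightarrow> 'd set \<Rightarrow> 'd action list \<Rightarrow> 'd config \<Rightarrow> bool" where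
  "raised q K \<sigma> y \<longleftrightarrow>
     run q \<sigma> y \<and> proj K y \<in> proj K ` states G \<and>
     labelled_path (edge (proj_graph J G)) (proj J q) \<sigma> (proj J y) \<and>
     (\<forall>i \<in> K. enat (reserve (vas_norm A) s x (card (- K))) \<le> y i) \<and>
     length \<sigma> \<le> (\<Sum>j \<in> {card (- K)<..card (- I)}. threshold x j ^ j)"

lemma raised_start:
  assumes "q \<in> states G"
  shows "raised q I [] q"
  using witness_graphD(3)[OF witness assms] assms
  by (auto simp: raised_def run_def stars_def)

lemma raised_step:
  assumes q: "q \<in> states G" and R: "raised q K \<sigma> y" and IK: "I \<subseteq> K" and KJ: "K \<subset> J"
  shows "\<exists>i \<tau> z. i \<in> J - K \<and> raised q (insert i K) \<tau> z"
proof -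
  define n where "n = card (- K)"
  let ?big = "\<lambda>u. \<exists>i \<in> J - K. enat (threshold x n) \<le> u i"
  have Kd: "card (- J) \<le> n"
    unfolding n_def using KJ by (intro card_mono) auto
  \<comment> \<open>Components outside \<open>J\<close> are small at every stage, so a large
    component outside \<open>K\<close> must lie in \<open>J\<close>.\<close>
  have below: "u i < enat (threshold x n)" if "u \<in> states G" "i \<notin> J" for u i
    using bounded that threshold_mono[OF x_ge_1 Kd]
    by (force simp: bounded_outside_def intro: less_le_trans)
  obtain u i where u: "u \<in> states G" "i \<in> - K" "enat (threshold x n) \<le> u i"
    using minimal[OF KJ] by (auto simp: bounded_outside_def n_def not_less)
  then have "i \<in> J" using below[of u i] by force
  then have "?big (proj K u)" using u by (auto simp: proj_def)
  moreover have "proj K y \<in> proj K ` states G" using R by (simp add: raised_def)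
  ultimately obtain \<rho> t where \<rho>: "labelled_path (edge (proj_graph K G)) (proj K y) \<rho> t" "?big t"
    "length \<rho> \<le> card {u \<in> proj K ` states G. \<not> ?big u}"
    using short_proj_path[where P = ?big] u(1) by blast
  \<comment> \<open>On \<open>J - K\<close> the bound holds because \<open>u\<close> is not big,
    outside \<open>J\<close> by \<open>below\<close>.\<close>
  have "{u \<in> proj K ` states G. \<not> ?big u} \<subseteq> bounded_configs K (threshold x n)"
    using below by (fastforce simp: bounded_configs_def proj_def not_le)
  then have "length \<rho> \<le> threshold x n ^ n"
    using \<rho>(3) card_bounded_configs[of K "threshold x n"] card_mono[OF finite_bounded_configs]
    unfolding n_def by (meson order_trans)
  \<comment> \<open>The shortest path may end elsewhere than at the projection of \<open>u\<close>,
    so the index is chosen afresh.\<close>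
  obtain i where i: "i \<in> J - K" "enat (threshold x n) \<le> t i" using \<rho>(2) by blast
  define m where "m = card (- insert i K)"
  have nm: "n = Suc m"
  proof -
    have "- K = insert i (- insert i K)" using i by auto
    then show ?thesis unfolding n_def m_def by (metis ComplD card_insert_disjoint finite insertI1)
  qed
  have yI: "stars y = I"
    using R run_stars witness_graphD(3)[OF witness q] by (auto simp: raised_def)
  let ?r = "reserve (vas_norm A) s x"
  \<comment> \<open>The summand that \<open>reserve\<close> loses from \<open>n\<close> to
    \<open>m\<close> pays for \<rho>.\<close>
  have "?r m + vas_norm A * length \<rho> \<le> ?r n"
    using \<open>length \<rho> \<le> threshold x n ^ n\<close> unfolding nm reserve_Suc by (simp add: mult_le_mono2)
  then have "enat (?r m + vas_norm A * length \<rho>) \<le> y i" if "i \<in> K" for i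
    using R that by (auto simp: raised_def n_def[symmetric] intro: order_trans[rotated])
  from run_lift[OF witness finite_A IK \<rho>(1) yI this]
  obtain z where z: "run y \<rho> z" "proj K z = t" "\<forall>i \<in> K. enat (?r m) \<le> z i" by blast
  have "raised q (insert i K) (\<sigma> @ \<rho>) z"
    unfolding raised_def m_def[symmetric]
  proof (intro conjI ballI)
    show "run q (\<sigma> @ \<rho>) z"
      using R z(1) by (auto simp: raised_def run_def labelled_path_append)
    have "proj K z \<in> proj K ` states G"
      using proj_path_states[OF \<rho>(1)] R z(2) by (simp add: raised_def)
    then have "proj (insert i K) (proj K z) \<in> proj (insert i K) ` proj K ` states G" by blast
    then show "proj (insert i K) z \<in> proj (insert i K) ` states G"
      by (simp add: image_image proj_proj subset_insertI)
    have "labelled_path (edge (proj_graph J G)) (proj J (proj K y)) \<rho> (proj J t)"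
      using \<rho>(1) by (rule labelled_path_map) (use KJ edge_proj_graph_mono in blast)
    then show "labelled_path (edge (proj_graph J G)) (proj J q) (\<sigma> @ \<rho>) (proj J z)"
      using R KJ z(2) by (auto simp: raised_def labelled_path_append proj_proj)
    show "enat (?r m) \<le> z k" if "k \<in> insert i K" for k
    proof (cases "k \<in> K")
      \<comment> \<open>The new component is outside \<open>K\<close>, so it is exact in
        \<open>t\<close>: its size is at least \<open>threshold x n\<close>, which covers the
        reserve for \<open>m\<close>.\<close>
      case False
      then have "k = i" "z i = t i" using that z(2) by (auto simp: proj_def)
      moreover have "?r m \<le> threshold x n"
        unfolding nm using s x by (rule reserve_le_threshold)
      ultimately show ?thesis using i(2) by (metis enat_ord_simps(1) order_trans)
    qed (use z(3) in blast)
    have "n \<le> card (- I)" unfolding n_def using IK by (intro card_mono) auto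
    then have "{m<..card (- I)} = insert n {n<..card (- I)}" using nm by auto
    then show "length (\<sigma> @ \<rho>) \<le> (\<Sum>j \<in> {m<..card (- I)}. threshold x j ^ j)"
      using R \<open>length \<rho> \<le> threshold x n ^ n\<close> by (simp add: raised_def n_def[symmetric])
  qed
  then show ?thesis using i(1) by blast
qed

lemma raised_all:
  assumes q: "q \<in> states G"
  shows "\<exists>\<sigma> y. raised q J \<sigma> y"
proof -
  have "\<exists>\<sigma> y. raised q J \<sigma> y" if "raised q K \<sigma> y" "I \<subseteq> K" "K \<subseteq> J" for K \<sigma> y
    using that
  proof (induction "card (J - K)" arbitrary: K \<sigma> y rule: less_induct)
    case less
    show ?case
    proof (cases "K = J")
      case False
      then obtain i \<tau> z where i: "i \<in> J - K" and "raised q (insert i K) \<tau> z"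
        using raised_step[OF q less.prems(1,2)] less.prems(3) by blast
      moreover have "card (J - insert i K) < card (J - K)"
        using i by (intro psubset_card_mono) auto
      ultimately show ?thesis using less.hyps less.prems by blast
    qed (use less.prems in blast)
  qed
  then show ?thesis using raised_start[OF q] I_subset_J by blast
qed

text \<open>The last reserve pays for the return to \<open>proj J q\<close> and leaves at least
  \<open>s\<close> on \<open>J\<close>, more than any finite component of \<open>q\<close>; hence
  strict growth on all of \<open>J - I\<close>.\<close>

lemma forward_pumpable_short:
  assumes q: "q \<in> states G" and norm: "config_norm q < s"
  shows "\<exists>\<sigma>. forward_pumpable (proj_graph J G) q (proj J q) \<sigma> \<and>
    length \<sigma> \<le> CARD('d) * x ^ (CARD('d) ^ CARD('d))"
proof -
  let ?d = "CARD('d)"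
  define n where "n = card (- J)"
  let ?r = "reserve (vas_norm A) s x"
  obtain \<sigma> y where R: "raised q J \<sigma> y" using raised_all[OF q] by blast
  have qJ: "proj J q \<in> proj J ` states G" and yJ: "proj J y \<in> proj J ` states G"
    using R q by (auto simp: raised_def)
  obtain \<rho> where \<rho>: "labelled_path (edge (proj_graph J G)) (proj J y) \<rho> (proj J q)"
    "length \<rho> \<le> card {u \<in> proj J ` states G. u \<noteq> proj J q}"
    using short_proj_path[OF yJ qJ, of "\<lambda>u. u = proj J q"] by blast
  have "{u \<in> proj J ` states G. u \<noteq> proj J q} = proj J ` states G - {proj J q}" by blast
  \<comment> \<open>The target itself is not counted. The \<open>- 1\<close> is needed for
    \<open>n = 0\<close>, where the power is 1 but the sum below is empty.\<close>
  then have "length \<rho> \<le> threshold x n ^ n - 1"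
    using \<rho>(2) card_states_proj qJ witness_graphD(2)[OF witness] by (simp add: n_def)
  then have len: "length \<rho> \<le> (\<Sum>j \<in> {1..n}. threshold x j ^ j)"
    by (cases n) auto
  have yI: "stars y = I"
    using R run_stars witness_graphD(3)[OF witness q] by (auto simp: raised_def)
  have "s + vas_norm A * length \<rho> \<le> ?r n"
    using len by (simp add: reserve_def mult_le_mono2)
  then have "enat (s + vas_norm A * length \<rho>) \<le> y i" if "i \<in> J" for i
    using R that by (auto simp: raised_def n_def[symmetric] intro: order_trans[rotated])
  from run_lift[OF witness finite_A I_subset_J \<rho>(1) yI this]
  obtain z where z: "run y \<rho> z" "proj J z = proj J q" "\<forall>i \<in> J. enat s \<le> z i" by blast
  have run: "run q (\<sigma> @ \<rho>) z"
    using R z(1) by (auto simp: raised_def run_def labelled_path_append)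
  have qI: "q i = \<infinity> \<longleftrightarrow> i \<in> I" and zI: "z i = \<infinity> \<longleftrightarrow> i \<in> I" for i
    using run_stars[OF run] witness_graphD(3)[OF witness q] by (auto simp: stars_def)
  have out: "z i = q i" if "i \<notin> J" for i
    using fun_cong[OF z(2), of i] that by (simp add: proj_def)
  have less: "q i < z i" if "i \<in> J - I" for i
  proof -
    have "q i \<le> enat (config_norm q)" using that qI by (intro le_config_norm) auto
    also have "\<dots> < enat s" using norm by simp
    also have "\<dots> \<le> z i" using z(3) that by blast
    finally show ?thesis .
  qed
  \<comment> \<open>Components in \<open>I\<close> are \<infinity> on both sides and do not count as
    changed, but \<open>q\<close> is already \<infinity> there, so the projection is still
    \<open>proj J q\<close>.\<close>
  have "{i. q i \<noteq> z i} = J - I"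
  proof (rule set_eqI)
    fix i
    show "i \<in> {i. q i \<noteq> z i} \<longleftrightarrow> i \<in> J - I"
      using out[of i] less[of i] qI[of i] zI[of i] by (cases "i \<in> I"; cases "i \<in> J") auto
  qed
  moreover have "proj (J - I) q = proj J q"
    using qI by (auto simp: proj_def)
  moreover have "q \<le> z"
    unfolding le_fun_def using out less qI zI by (metis Diff_iff order_less_imp_le order_refl)
  ultimately have "forward_limit (\<sigma> @ \<rho>) q (proj J q)"
    using run by (auto simp: forward_limit_def)
  moreover have "cycle_at (proj_graph J G) (proj J q) (\<sigma> @ \<rho>)"
    using R \<rho>(1) qJ by (auto simp: cycle_at_def graph_path_def raised_def labelled_path_append)
  moreover have "length (\<sigma> @ \<rho>) \<le> ?d * x ^ (?d ^ ?d)"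
  proof -
    have "n \<le> card (- I)"
      unfolding n_def using I_subset_J by (intro card_mono) auto
    \<comment> \<open>The raising stages and the bound for the return use disjoint ranges of
      \<open>j\<close>: at most \<open>d\<close> summands, each at most
      \<open>x ^ (d ^ d)\<close>.\<close>
    then have split: "{1..card (- I)} = {1..n} \<union> {n<..card (- I)}" by auto
    have "length (\<sigma> @ \<rho>) \<le> (\<Sum>j \<in> {1..n}. threshold x j ^ j) + (\<Sum>j \<in> {n<..card (- I)}. threshold x j ^ j)"
      using R len by (simp add: raised_def n_def)
    also have "\<dots> = (\<Sum>j \<in> {1..card (- I)}. threshold x j ^ j)"
      unfolding split by (subst sum.union_disjoint) auto
    also have "\<dots> \<le> (\<Sum>j \<in> {1..card (- I)}. x ^ (?d ^ ?d))"
    proof (rule sum_mono)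
      fix j assume "j \<in> {1..card (- I)}"
      then show "threshold x j ^ j \<le> x ^ (?d ^ ?d)"
        using card_mono[of UNIV "- I"] by (intro threshold_power_le[OF x_ge_1]) simp
    qed
    also have "\<dots> = card (- I) * x ^ (?d ^ ?d)" by simp
    also have "\<dots> \<le> ?d * x ^ (?d ^ ?d)"
      using card_mono[of UNIV "- I"] by (intro mult_le_mono1) simp
    finally show ?thesis .
  qed
  ultimately show ?thesis by (auto simp: forward_pumpable_def)
qed

end

section \<open>Reversal\<close>

definition rev_graph :: "'d vas_graph \<Rightarrow> 'd vas_graph" where
  "rev_graph G =
     \<lparr> states = states G, transitions = (\<lambda>(x, a, y). (y, - a, x)) ` transitions G \<rparr>"

lemma states_rev_graph [simp]: "states (rev_graph G) = states G"
  by (simp add: rev_graph_def)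

lemma edge_rev_graph: "edge (rev_graph G) u a v \<longleftrightarrow> edge G v (- a) u"
proof -
  have "- (- b) = b" for b :: "'d action" by (simp add: fun_eq_iff)
  then have "b = - a \<longleftrightarrow> a = - b" for b by metis
  then show ?thesis by (force simp: rev_graph_def image_iff)
qed

lemma step_rev: "step u a v \<Longrightarrow> step v (- a) u"
  by (auto simp: step_def)

lemma witness_rev_graph:
  assumes W: "witness_graph A I G"
  shows "witness_graph (uminus ` A) I (rev_graph G)"
proof -
  have "finite (transitions G)" "states G \<subseteq> configs I"
    using W by (auto simp: witness_graph_def subreachability_graph_def)
  then have "subreachability_graph (uminus ` A) I (rev_graph G)"
    using witness_graphD(1,2,4)[OF W] step_rev
    by (force simp: subreachability_graph_def run_def labelled_path_Cons rev_graph_def)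
  moreover have "\<exists>\<sigma>. graph_path (rev_graph G) p \<sigma> q" if pq: "p \<in> states G" "q \<in> states G" for p q
  proof -
    obtain \<sigma> where "labelled_path (edge G) q \<sigma> p" using witness_graphD(5)[OF W] pq by blast
    then have "labelled_path (edge (rev_graph G)) p (rev (map uminus \<sigma>)) q"
      by (rule labelled_path_rev) (force simp: rev_graph_def)
    then show ?thesis using pq by (auto simp: graph_path_def)
  qed
  ultimately show ?thesis by (simp add: witness_graph_def)
qed

text \<open>Reversing the run from \<open>q\<close> to \<open>y\<close> leaves the pair compared in
  the limit unchanged, so \<open>p\<close> carries over.\<close>

lemma backward_pumpable_rev:
  assumes "forward_pumpable (proj_graph J (rev_graph G)) q p \<sigma>"
  shows "backward_pumpable (proj_graph J G) q p (rev (map uminus \<sigma>))"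
proof -
  obtain y where y: "run q \<sigma> y" "q \<le> y" "p = proj {i. q i \<noteq> y i} q"
    using assms by (auto simp: forward_pumpable_def forward_limit_def)
  have "run y (rev (map uminus \<sigma>)) q"
    using y(1) unfolding run_def by (rule labelled_path_rev) (rule step_rev)
  moreover have path: "labelled_path (edge (proj_graph J (rev_graph G))) p \<sigma> p"
    and "p \<in> states (proj_graph J G)"
    using assms by (auto simp: forward_pumpable_def cycle_at_def graph_path_def)
  moreover have "labelled_path (edge (proj_graph J G)) p (rev (map uminus \<sigma>)) p"
    using path by (rule labelled_path_rev) (auto simp: edge_proj_graph edge_rev_graph)
  ultimately show ?thesis
    using y by (auto simp: backward_pumpable_def backward_limit_def cycle_at_def graph_path_def)
qed

section \<open>Choice of \<open>J\<close> and combination of the two directions\<close>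

theorem theorem9p1:
  fixes A :: "'d::finite action set"
    and I :: "'d set"
    and G :: "'d vas_graph"
    and s x d :: nat
  assumes "d = CARD('d)"
    and "finite A"
    and "witness_graph A I G"
    and "s \<ge> 1"
    and "x = (1 + vas_norm A) * s"
  shows "\<exists>J :: 'd set.
    card (states (proj_graph J G)) \<le> x ^ (d ^ d) \<and>
    (\<forall>q \<in> states G. config_norm q < s \<longrightarrow>
      (\<exists>p \<sigma>. forward_pumpable (proj_graph J G) q p \<sigma> \<and> length \<sigma> \<le> d * x ^ (d ^ d)) \<and>
      (\<exists>p \<sigma>. backward_pumpable (proj_graph J G) q p \<sigma> \<and> length \<sigma> \<le> d * x ^ (d ^ d)))"
proof -
  \<comment> \<open>\<open>UNIV\<close> qualifies vacuously, so a set of least cardinality exists;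
    it is then minimal for inclusion.\<close>
  have "bounded_outside x (states G) UNIV" by (simp add: bounded_outside_def)
  then obtain J where J: "bounded_outside x (states G) J"
    and least: "\<And>K. bounded_outside x (states G) K \<Longrightarrow> card J \<le> card K"
    using ex_has_least_nat[of "bounded_outside x (states G)" UNIV card] by blast
  have minimal: "\<not> bounded_outside x (states G) K" if "K \<subset> J" for K
    using least[of K] psubset_card_mono[OF _ that] by fastforce
  interpret fwd: pumping A I G s x J
    using assms J minimal by unfold_locales
  \<comment> \<open>Reversal keeps the states and the norm of the actions, hence also
    \<open>x\<close> and the minimality of \<open>J\<close>.\<close>
  interpret bwd: pumping "uminus ` A" I "rev_graph G" s x J
    using assms J minimal witness_rev_graph by unfold_locales (auto simp: vas_norm_uminus)
  show ?thesis
  proof (intro exI[of _ J] conjI ballI impI)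
    have "card (- J) \<le> d" unfolding assms(1) by (intro card_mono) auto
    then show "card (states (proj_graph J G)) \<le> x ^ (d ^ d)"
      using fwd.card_states_proj threshold_power_le[OF fwd.x_ge_1] order_trans by blast
  next
    fix q assume q: "q \<in> states G" "config_norm q < s"
    show "\<exists>p \<sigma>. forward_pumpable (proj_graph J G) q p \<sigma> \<and> length \<sigma> \<le> d * x ^ (d ^ d)"
      using fwd.forward_pumpable_short[OF q] assms(1) by blast
    obtain \<sigma> where "forward_pumpable (proj_graph J (rev_graph G)) q (proj J q) \<sigma>"
      "length \<sigma> \<le> d * x ^ (d ^ d)"
      using bwd.forward_pumpable_short q assms(1) by auto
    then show "\<exists>p \<sigma>. backward_pumpable (proj_graph J G) q p \<sigma> \<and> length \<sigma> \<le> d * x ^ (d ^ d)"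
      using backward_pumpable_rev by (metis length_map length_rev)
  qed
qed

end
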